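(* Let $G$ be a group and let $\mathcal{F}$ be a family consisting of distinct subgroups of $G$ of finite exponent, closed under conjugation (i.e. $F^g=g^{-1}Fg\in\mathcal{F}$ for all $F\in\mathcal{F}$ and $g\in G$). If there exists a positive integer $n$ such that for every $F\in\mathcal{F}$ the exponent of $F$ divides $n$ and $F$ is $C_n$-cellular, then the active sum $S$ of the family $\mathcal{F}$ is $C_n$-cellular.
   Context: $C_n$ denotes a (multiplicative) cyclic group of order $n$. Active sum: for a family $\mathcal{F}$ of distinct subgroups of a group $G$ closed under conjugation, the active sum $S$ of $\mathcal{F}$ is the quotient of the free product $\amalg_{F\in\mathcal{F}}F$ of the groups in $\mathcal{F}$ by the normal subgroup generated by all elements of the form $h^{-1}\cdot g\cdot h\cdot (g^h)^{-1}$ with $h\in F_1$, $g\in F_2$, $F_1,F_2\in\mathcal{F}$. Here the products are taken in the free product ($h$ in the factor $F_1$, $g$ in the factor $F_2$), while $g^h=h^{-1}gh$ is the conjugate computed in $G$, regarded as an element of the factor $F_2^h=h^{-1}F_2h\in\mathcal{F}$. Cellularity: for a group $A$, a group homomorphism $f:X\to Y$ is an $A$-equivalence if the map $\mathrm{Hom}(A,f):\mathrm{Hom}(A,X)\to\mathrm{Hom}(A,Y)$, $t\mapsto f\circ t$, is a bijection. A group $H$ is $A$-cellular if every $A$-equivalence $f:X\to Y$ (for arbitrary groups $X,Y$) is also an $H$-equivalence. *)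

theory Defs
  imports "HOL-Algebra.Elementary_Groups"
begin

definition finite_exponent :: "('a, 'b) monoid_scheme \<Rightarrow> bool" where
  "finite_exponent G \<longleftrightarrow> (\<exists>m>0. \<forall>x\<in>carrier G. x [^]\<^bsub>G\<^esub> (m::nat) = \<one>\<^bsub>G\<^esub>)"

definition group_exponent :: "('a, 'b) monoid_scheme \<Rightarrow> nat" where
  "group_exponent G =
    (if finite_exponent G
     then LEAST m. 0 < m \<and> (\<forall>x\<in>carrier G. x [^]\<^bsub>G\<^esub> m = \<one>\<^bsub>G\<^esub>)
     else 0)"

text \<open>HOL functions are total, so a homomorphism is represented by the unique function that
  is undefined outside the carrier. Without this, the maps between sets of homomorphisms below
  could not be compared for bijectivity.\<close>

definition Hom :: "('a, 'b) monoid_scheme \<Rightarrow> ('c, 'd) monoid_scheme \<Rightarrow> ('a \<Rightarrow> 'c) set" where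
  "Hom A X = hom A X \<inter> extensional (carrier A)"

definition equivalence_wrt ::
    "('a, 'b) monoid_scheme \<Rightarrow> ('x, 'c) monoid_scheme \<Rightarrow> ('y, 'd) monoid_scheme \<Rightarrow> ('x \<Rightarrow> 'y) \<Rightarrow> bool"
  where
  "equivalence_wrt A X Y f \<longleftrightarrow>
    f \<in> hom X Y \<and> bij_betw (\<lambda>t. compose (carrier A) f t) (Hom A X) (Hom A Y)"

text \<open>HOL cannot quantify over types inside a formula, so the element types of the test groups
  \<open>X\<close> and \<open>Y\<close> are parameters. Being cellular means satisfying this predicate for all \<open>'x\<close>
  and \<open>'y\<close>.\<close>

definition cellular ::
    "'x itself \<Rightarrow> 'y itself \<Rightarrow> ('a, 'b) monoid_scheme \<Rightarrow> ('h, 'c) monoid_scheme \<Rightarrow> bool"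
  where
  "cellular (_ :: 'x itself) (_ :: 'y itself) A H \<longleftrightarrow>
    (\<forall>(X :: 'x monoid) (Y :: 'y monoid) f.
      group X \<longrightarrow> group Y \<longrightarrow> equivalence_wrt A X Y f \<longrightarrow> equivalence_wrt H X Y f)"

text \<open>The free product of the groups \<open>H i\<close>, for \<open>i \<in> I\<close>, is the monoid of words in the disjoint
  union of the carriers, modulo the congruence that multiplies adjacent letters from the same
  factor and deletes unit letters.\<close>

definition free_product_words :: "'i set \<Rightarrow> ('i \<Rightarrow> ('a, 'b) monoid_scheme) \<Rightarrow> ('i \<times> 'a) list set"
  where "free_product_words I H = lists (SIGMA i:I. carrier (H i))"

inductive_set free_product_rel ::
    "'i set \<Rightarrow> ('i \<Rightarrow> ('a, 'b) monoid_scheme) \<Rightarrow> (('i \<times> 'a) list \<times> ('i \<times> 'a) list) set"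
  for I :: "'i set" and H :: "'i \<Rightarrow> ('a, 'b) monoid_scheme"
  where
    refl: "u \<in> free_product_words I H \<Longrightarrow> (u, u) \<in> free_product_rel I H"
  | sym: "(u, v) \<in> free_product_rel I H \<Longrightarrow> (v, u) \<in> free_product_rel I H"
  | trans: "\<lbrakk>(u, v) \<in> free_product_rel I H; (v, w) \<in> free_product_rel I H\<rbrakk>
      \<Longrightarrow> (u, w) \<in> free_product_rel I H"
  | unit: "\<lbrakk>u \<in> free_product_words I H; v \<in> free_product_words I H; i \<in> I\<rbrakk>
      \<Longrightarrow> (u @ [(i, \<one>\<^bsub>H i\<^esub>)] @ v, u @ v) \<in> free_product_rel I H"
  | mult: "\<lbrakk>u \<in> free_product_words I H; v \<in> free_product_words I H; i \<in> I;
       x \<in> carrier (H i); y \<in> carrier (H i)\<rbrakk>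
      \<Longrightarrow> (u @ [(i, x), (i, y)] @ v, u @ [(i, x \<otimes>\<^bsub>H i\<^esub> y)] @ v) \<in> free_product_rel I H"

definition free_product ::
    "'i set \<Rightarrow> ('i \<Rightarrow> ('a, 'b) monoid_scheme) \<Rightarrow> ('i \<times> 'a) list set monoid" where
  "free_product I H =
    \<lparr>carrier = free_product_words I H // free_product_rel I H,
     mult = (\<lambda>P Q. \<Union>u\<in>P. \<Union>v\<in>Q. free_product_rel I H `` {u @ v}),
     one = free_product_rel I H `` {[]}\<rparr>"

definition free_product_inj ::
    "'i set \<Rightarrow> ('i \<Rightarrow> ('a, 'b) monoid_scheme) \<Rightarrow> 'i \<Rightarrow> 'a \<Rightarrow> ('i \<times> 'a) list set" where
  "free_product_inj I H i x = free_product_rel I H `` {[(i, x)]}"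

definition normal_closure :: "('a, 'b) monoid_scheme \<Rightarrow> 'a set \<Rightarrow> 'a set" where
  "normal_closure G R = \<Inter>{N. N \<lhd> G \<and> R \<subseteq> N}"

definition conj_elt :: "('a, 'b) monoid_scheme \<Rightarrow> 'a \<Rightarrow> 'a \<Rightarrow> 'a" where
  "conj_elt G h g = inv\<^bsub>G\<^esub> h \<otimes>\<^bsub>G\<^esub> g \<otimes>\<^bsub>G\<^esub> h"

text \<open>A family of distinct subgroups is a set of subgroups, and it serves as its own index set.\<close>

definition family_free_product ::
    "('a, 'b) monoid_scheme \<Rightarrow> 'a set set \<Rightarrow> ('a set \<times> 'a) list set monoid" where
  "family_free_product G \<F> = free_product \<F> (\<lambda>F. G\<lparr>carrier := F\<rparr>)"

definition family_inj ::
    "('a, 'b) monoid_scheme \<Rightarrow> 'a set set \<Rightarrow> 'a set \<Rightarrow> 'a \<Rightarrow> ('a set \<times> 'a) list set" where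
  "family_inj G \<F> F x = free_product_inj \<F> (\<lambda>F. G\<lparr>carrier := F\<rparr>) F x"

definition active_sum_relators ::
    "('a, 'b) monoid_scheme \<Rightarrow> 'a set set \<Rightarrow> ('a set \<times> 'a) list set set" where
  "active_sum_relators G \<F> =
    (let P = family_free_product G \<F>; \<iota> = family_inj G \<F> in
     {inv\<^bsub>P\<^esub> (\<iota> F1 h) \<otimes>\<^bsub>P\<^esub> \<iota> F2 g \<otimes>\<^bsub>P\<^esub> \<iota> F1 h \<otimes>\<^bsub>P\<^esub> inv\<^bsub>P\<^esub> (\<iota> (conj_elt G h ` F2) (conj_elt G h g))
      | F1 F2 h g. F1 \<in> \<F> \<and> F2 \<in> \<F> \<and> h \<in> F1 \<and> g \<in> F2})"

definition active_sum ::
    "('a, 'b) monoid_scheme \<Rightarrow> 'a set set \<Rightarrow> ('a set \<times> 'a) list set set monoid" where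
  "active_sum G \<F> =
    family_free_product G \<F>
      Mod normal_closure (family_free_product G \<F>) (active_sum_relators G \<F>)"

end

theory Submission
  imports Defs "HOL-Algebra.Multiplicative_Group"
begin

text \<open>
  A homomorphism from \<open>C\<^sub>n\<close> to a group \<open>X\<close> is the choice of an element \<open>x\<close> with
  \<open>x\<^sup>n = 1\<close>, the image of a generator. Hence a \<open>C\<^sub>n\<close>-equivalence \<open>f : X \<rightarrow> Y\<close> is injective
  on the elements of \<open>X\<close> killed by \<open>n\<close>; this is lemma \<open>equivalence_cyclic_inj_on_torsion\<close>.

  The active sum \<open>S\<close> is defined by generators and relations, so a homomorphism \<open>S \<rightarrow> X\<close> is
  the same as a family of homomorphisms \<open>\<phi>\<^sub>F : F \<rightarrow> X\<close> that respects conjugation: the image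
  of \<open>g\<^sup>h\<close> is the conjugate of the image of \<open>g\<close> by the image of \<open>h\<close>. Uniqueness is \<open>active_sum_hom_eqI\<close> and existence
  is \<open>active_sum_universal\<close>.

  Let \<open>f : X \<rightarrow> Y\<close> be a \<open>C\<^sub>n\<close>-equivalence. As every \<open>F\<close> is \<open>C\<^sub>n\<close>-cellular, composition with \<open>f\<close>
  is a bijection from the homomorphisms \<open>F \<rightarrow> X\<close> to the homomorphisms \<open>F \<rightarrow> Y\<close>. Two
  homomorphisms \<open>S \<rightarrow> X\<close> with the same composite with \<open>f\<close> therefore agree on each \<open>F\<close>, and
  so are equal. Conversely, given \<open>t : S \<rightarrow> Y\<close>, its composite with each \<open>F \<rightarrow> S\<close> lifts to
  some \<open>\<phi>\<^sub>F : F \<rightarrow> X\<close>. It remains to see that these lifts respect conjugation. The two sides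
  of the required equation have the same image under \<open>f\<close>, since \<open>t\<close> satisfies the relations
  of \<open>S\<close>, and both are killed by \<open>n\<close>, since the exponents of the members of the family divide
  \<open>n\<close> and conjugation preserves the order of an element. By injectivity of \<open>f\<close> on such
  elements the two sides are equal, so the lifts assemble to a homomorphism \<open>S \<rightarrow> X\<close> over \<open>t\<close>.
\<close>

section \<open>Free products\<close>

lemma free_product_words_append [simp]:
  "u @ v \<in> free_product_words I H \<longleftrightarrow> u \<in> free_product_words I H \<and> v \<in> free_product_words I H"
  by (auto simp: free_product_words_def)

lemma free_product_words_Nil [simp]: "[] \<in> free_product_words I H"
  by (simp add: free_product_words_def)

lemma free_product_words_Cons [simp]:
  "(i, x) # w \<in> free_product_words I H \<longleftrightarrow>
    i \<in> I \<and> x \<in> carrier (H i) \<and> w \<in> free_product_words I H"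
  by (auto simp: free_product_words_def)

locale groups_family =
  fixes I :: "'i set" and H :: "'i \<Rightarrow> ('a, 'b) monoid_scheme"
  assumes group_factor: "i \<in> I \<Longrightarrow> group (H i)"
begin

abbreviation words where "words \<equiv> free_product_words I H"
abbreviation rel where "rel \<equiv> free_product_rel I H"
abbreviation word_class where "word_class w \<equiv> rel `` {w}"
abbreviation FP where "FP \<equiv> free_product I H"
abbreviation incl where "incl \<equiv> free_product_inj I H"

lemma rel_words: "(u, v) \<in> rel \<Longrightarrow> u \<in> words \<and> v \<in> words"
proof (induction rule: free_product_rel.induct)
  case (unit u v i)
  then show ?case
    using group.is_monoid[OF group_factor, of i] by (simp add: monoid.one_closed)
next
  case (mult u v i x y)
  then show ?case
    using group.is_monoid[OF group_factor, of i] by (simp add: monoid.m_closed)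
qed auto

lemma equiv_rel: "equiv words rel"
proof (rule equivI)
  show "rel \<subseteq> words \<times> words" using rel_words by auto
  show "refl_on words rel" by (auto simp: refl_on_def intro: free_product_rel.refl)
  show "Relation.sym rel" by (auto simp: sym_def intro: free_product_rel.sym)
  show "Relation.trans rel" by (auto simp: trans_def intro: free_product_rel.trans)
qed

lemma rel_context: "(u, v) \<in> rel \<Longrightarrow> p \<in> words \<Longrightarrow> q \<in> words \<Longrightarrow> (p @ u @ q, p @ v @ q) \<in> rel"
proof (induction rule: free_product_rel.induct)
  case (refl u)
  then show ?case by (simp add: free_product_rel.refl)
next
  case (sym u v)
  then show ?case by (blast intro: free_product_rel.sym)
next
  case (trans u v w)
  then show ?case by (blast intro: free_product_rel.trans)
next
  case (unit u v i)
  then show ?case using free_product_rel.unit[of "p @ u" I H "v @ q" i] by simp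
next
  case (mult u v i x y)
  then show ?case using free_product_rel.mult[of "p @ u" I H "v @ q" i x y] by simp
qed

lemma rel_append:
  assumes "(u, u') \<in> rel" "(v, v') \<in> rel"
  shows "(u @ v, u' @ v') \<in> rel"
proof -
  have "(u @ v, u' @ v) \<in> rel" "(u' @ v, u' @ v') \<in> rel"
    using rel_context[OF assms(1), of "[]" v] rel_context[OF assms(2), of u' "[]"]
      rel_words assms by auto
  then show ?thesis by (rule free_product_rel.trans)
qed

lemma carrier_free_product: "carrier FP = word_class ` words"
  by (auto simp: free_product_def quotient_def)

lemma word_class_closed [simp]: "w \<in> words \<Longrightarrow> word_class w \<in> carrier FP"
  by (simp add: carrier_free_product)

lemma one_free_product: "\<one>\<^bsub>FP\<^esub> = word_class []"
  by (simp add: free_product_def)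

lemma mult_word_class:
  assumes "u \<in> words" "v \<in> words"
  shows "word_class u \<otimes>\<^bsub>FP\<^esub> word_class v = word_class (u @ v)"
proof -
  have "congruent2 rel rel (\<lambda>u v. word_class (u @ v))"
    by (auto simp: congruent2_def intro!: equiv_class_eq[OF equiv_rel] rel_append)
  from UN_equiv_class2[OF equiv_rel equiv_rel this assms] show ?thesis
    by (simp add: free_product_def)
qed

text \<open>Reversing a word and inverting its letters inverts its class, as the two words cancel
  from the middle outwards.\<close>

lemma word_class_left_inverse:
  assumes "w \<in> words"
  shows "\<exists>v\<in>words. (v @ w, []) \<in> rel"
  using assms
proof (induction w)
  case Nil
  show ?case by (intro bexI[of _ "[]"]) (auto intro: free_product_rel.refl)
next
  case (Cons a w)
  obtain i x where a: "a = (i, x)" by fastforce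
  with Cons obtain v where v: "v \<in> words" "(v @ w, []) \<in> rel"
    and ix: "i \<in> I" "x \<in> carrier (H i)" "w \<in> words" by auto
  interpret Hi: group "H i" using ix group_factor by simp
  let ?v = "v @ [(i, inv\<^bsub>H i\<^esub> x)]"
  have "(?v @ a # w, v @ [(i, \<one>\<^bsub>H i\<^esub>)] @ w) \<in> rel"
    using free_product_rel.mult[of v I H w i "inv\<^bsub>H i\<^esub> x" x] v ix a by simp
  moreover have "(v @ [(i, \<one>\<^bsub>H i\<^esub>)] @ w, v @ w) \<in> rel"
    using free_product_rel.unit v ix by fast
  ultimately have "(?v @ a # w, []) \<in> rel"
    using v by (blast intro: free_product_rel.trans)
  moreover have "?v \<in> words" using v ix by simp
  ultimately show ?case by blast
qed

lemma group_free_product: "group FP"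
proof (rule groupI)
  show "\<exists>y\<in>carrier FP. y \<otimes>\<^bsub>FP\<^esub> x = \<one>\<^bsub>FP\<^esub>" if x: "x \<in> carrier FP" for x
  proof -
    obtain w where w: "w \<in> words" "x = word_class w"
      using x unfolding carrier_free_product by blast
    obtain v where v: "v \<in> words" "(v @ w, []) \<in> rel"
      using word_class_left_inverse w by blast
    have "word_class v \<otimes>\<^bsub>FP\<^esub> x = \<one>\<^bsub>FP\<^esub>"
      using equiv_class_eq[OF equiv_rel v(2)] v w
      by (simp add: mult_word_class one_free_product)
    with v show ?thesis by (blast intro: word_class_closed)
  qed
qed (auto simp: carrier_free_product one_free_product mult_word_class)

lemma incl_hom:
  assumes "i \<in> I"
  shows "incl i \<in> hom (H i) FP"
proof (rule homI)
  interpret Hi: group "H i" using assms group_factor by simp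
  fix x y assume xy: "x \<in> carrier (H i)" "y \<in> carrier (H i)"
  then show "incl i x \<in> carrier FP" using assms by (simp add: free_product_inj_def)
  have "([(i, x), (i, y)], [(i, x \<otimes>\<^bsub>H i\<^esub> y)]) \<in> rel"
    using free_product_rel.mult[of "[]" I H "[]" i x y] xy assms by simp
  then have "word_class [(i, x), (i, y)] = word_class [(i, x \<otimes>\<^bsub>H i\<^esub> y)]"
    by (rule equiv_class_eq[OF equiv_rel])
  then show "incl i (x \<otimes>\<^bsub>H i\<^esub> y) = incl i x \<otimes>\<^bsub>FP\<^esub> incl i y"
    using xy assms by (simp add: free_product_inj_def mult_word_class)
qed

text \<open>A word is the product of its letters, so the factors generate the free product.\<close>

lemma free_product_hom_eqI:
  assumes "group X" and a: "a \<in> hom FP X" and b: "b \<in> hom FP X"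
    and eq: "\<And>i x. i \<in> I \<Longrightarrow> x \<in> carrier (H i) \<Longrightarrow> a (incl i x) = b (incl i x)"
    and "p \<in> carrier FP"
  shows "a p = b p"
proof -
  have "a (word_class w) = b (word_class w)" if "w \<in> words" for w
    using that
  proof (induction w)
    case Nil
    show ?case
      using hom_one[OF a group_free_product \<open>group X\<close>] hom_one[OF b group_free_product \<open>group X\<close>]
      by (simp add: one_free_product)
  next
    case (Cons c w)
    obtain i x where c: "c = (i, x)" by fastforce
    have "word_class (c # w) = incl i x \<otimes>\<^bsub>FP\<^esub> word_class w"
      and cl: "incl i x \<in> carrier FP" "word_class w \<in> carrier FP"
      using Cons.prems c mult_word_class[of "[(i, x)]" w] by (auto simp: free_product_inj_def)
    moreover have "a (incl i x) = b (incl i x)" using Cons.prems c eq by simp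
    ultimately show ?case
      using Cons c hom_mult[OF a cl] hom_mult[OF b cl] by simp
  qed
  then show ?thesis using \<open>p \<in> carrier FP\<close> by (auto simp: carrier_free_product)
qed

text \<open>Multiplying out the images of the letters of a word gives the homomorphism; each generating
  step of the congruence preserves this product because every \<open>\<phi> i\<close> is a homomorphism.\<close>

lemma free_product_universal:
  assumes "group X" and \<phi>: "\<And>i. i \<in> I \<Longrightarrow> \<phi> i \<in> hom (H i) X"
  shows "\<exists>\<Phi>\<in>hom FP X. \<forall>i\<in>I. \<forall>x\<in>carrier (H i). \<Phi> (incl i x) = \<phi> i x"
proof -
  interpret X: group X by fact
  define ev where "ev = (\<lambda>w. foldr (\<lambda>(i, x) z. \<phi> i x \<otimes>\<^bsub>X\<^esub> z) w \<one>\<^bsub>X\<^esub>)"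
  have ev_simps [simp]: "ev [] = \<one>\<^bsub>X\<^esub>" "ev ((i, x) # w) = \<phi> i x \<otimes>\<^bsub>X\<^esub> ev w" for i x w
    by (simp_all add: ev_def)
  have \<phi>_closed [simp]: "\<phi> i x \<in> carrier X" if "i \<in> I" "x \<in> carrier (H i)" for i x
    using \<phi> that by (auto simp: hom_def)
  have ev_closed [simp]: "ev w \<in> carrier X" if "w \<in> words" for w
    using that by (induction w) auto
  have ev_append [simp]: "ev (u @ v) = ev u \<otimes>\<^bsub>X\<^esub> ev v" if "u \<in> words" "v \<in> words" for u v
    using that by (induction u) (auto simp: X.m_assoc)
  have ev_rel: "ev u = ev v" if "(u, v) \<in> rel" for u v
    using that
  proof (induction rule: free_product_rel.induct)
    case (unit u v i)
    then show ?case
      using group_factor[of i] hom_one[OF \<phi>, of i] \<open>group X\<close>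
      by (simp add: group.is_monoid monoid.one_closed)
  next
    case (mult u v i x y)
    then show ?case
      using group_factor[of i] hom_mult[OF \<phi>, of i x y]
      by (simp add: group.is_monoid monoid.m_closed X.m_assoc)
  qed auto
  define \<Phi> where "\<Phi> = (\<lambda>P. ev (SOME w. w \<in> P))"
  have \<Phi>: "\<Phi> (word_class w) = ev w" if "w \<in> words" for w
  proof -
    have "w \<in> word_class w" using that by (auto intro: free_product_rel.refl)
    then have "(SOME v. v \<in> word_class w) \<in> word_class w" by (rule someI)
    then show ?thesis using ev_rel by (simp add: \<Phi>_def)
  qed
  show ?thesis
  proof (intro bexI ballI)
    show "\<Phi> \<in> hom FP X"
      by (rule homI) (auto simp: carrier_free_product mult_word_class \<Phi>)
    show "\<Phi> (incl i x) = \<phi> i x" if "i \<in> I" "x \<in> carrier (H i)" for i x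
      using that by (simp add: free_product_inj_def \<Phi>)
  qed
qed

end

section \<open>Normal closures\<close>

context group
begin

lemma normal_Inter:
  assumes "\<N> \<noteq> {}" "\<And>N. N \<in> \<N> \<Longrightarrow> N \<lhd> G"
  shows "\<Inter>\<N> \<lhd> G"
  using assms by (auto simp: normal_inv_iff intro: subgroups_Inter)

lemma normal_closure_normal:
  assumes "R \<subseteq> carrier G"
  shows "normal_closure G R \<lhd> G"
proof -
  have "carrier G \<lhd> G"
    by (auto simp: normal_inv_iff subgroup_self)
  with assms show ?thesis
    unfolding normal_closure_def by (intro normal_Inter) auto
qed

lemma subset_normal_closure: "R \<subseteq> normal_closure G R"
  by (auto simp: normal_closure_def)

lemma normal_closure_minimal: "N \<lhd> G \<Longrightarrow> R \<subseteq> N \<Longrightarrow> normal_closure G R \<subseteq> N"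
  by (auto simp: normal_closure_def)

end

section \<open>Active sums\<close>

locale conjugation_closed_family = group G for G :: "('a, 'b) monoid_scheme" (structure) +
  fixes \<F> :: "'a set set"
  assumes subgroup_member: "F \<in> \<F> \<Longrightarrow> subgroup F G"
    and conj_member: "F \<in> \<F> \<Longrightarrow> g \<in> carrier G \<Longrightarrow> conj_elt G g ` F \<in> \<F>"
begin

sublocale groups_family \<F> "\<lambda>F. G\<lparr>carrier := F\<rparr>"
  by (rule groups_family.intro) (rule subgroup_imp_group[OF subgroup_member])

abbreviation P where "P \<equiv> family_free_product G \<F>"
abbreviation relators where "relators \<equiv> active_sum_relators G \<F>"
abbreviation relator_closure where "relator_closure \<equiv> normal_closure P relators"
abbreviation S where "S \<equiv> active_sum G \<F>"

definition active_inj where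
  "active_inj F x = relator_closure #>\<^bsub>P\<^esub> family_inj G \<F> F x"

lemma member_carrier: "F \<in> \<F> \<Longrightarrow> x \<in> F \<Longrightarrow> x \<in> carrier G"
  using subgroup_member subgroup.mem_carrier by metis

lemma group_P: "group P"
  unfolding family_free_product_def by (rule group_free_product)

lemma family_inj_hom: "F \<in> \<F> \<Longrightarrow> family_inj G \<F> F \<in> hom (G\<lparr>carrier := F\<rparr>) P"
  unfolding family_free_product_def
  using incl_hom by (simp add: family_inj_def[abs_def])

lemma family_inj_closed: "F \<in> \<F> \<Longrightarrow> x \<in> F \<Longrightarrow> family_inj G \<F> F x \<in> carrier P"
  using hom_in_carrier[OF family_inj_hom, of F x] by simp

lemma conj_image_closed:
  "F1 \<in> \<F> \<Longrightarrow> F2 \<in> \<F> \<Longrightarrow> h \<in> F1 \<Longrightarrow> conj_elt G h ` F2 \<in> \<F>"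
  by (intro conj_member member_carrier)

lemma relators_closed: "relators \<subseteq> carrier P"
proof -
  interpret P: group P by (rule group_P)
  show ?thesis
    by (auto simp: active_sum_relators_def Let_def family_inj_closed conj_image_closed
        intro!: P.m_closed P.inv_closed)
qed

lemma relator_closure_normal: "relator_closure \<lhd> P"
  by (rule group.normal_closure_normal[OF group_P relators_closed])

lemma active_sum_eq: "S = P Mod relator_closure"
  by (simp add: active_sum_def)

lemma group_active_sum: "group S"
  unfolding active_sum_eq by (rule normal.factorgroup_is_group[OF relator_closure_normal])

lemma projection_hom: "(\<lambda>p. relator_closure #>\<^bsub>P\<^esub> p) \<in> hom P S"
  unfolding active_sum_eq by (rule normal.r_coset_hom_Mod[OF relator_closure_normal])

lemma active_inj_hom: "F \<in> \<F> \<Longrightarrow> active_inj F \<in> hom (G\<lparr>carrier := F\<rparr>) S"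
  using Group.hom_compose[OF family_inj_hom projection_hom]
  by (simp add: active_inj_def[abs_def] comp_def)

text \<open>The relators become trivial in the quotient, so conjugation in \<open>G\<close> is realised by
  conjugation in \<open>S\<close>.\<close>

lemma active_inj_conj:
  assumes F: "F1 \<in> \<F>" "F2 \<in> \<F>" and hg: "h \<in> F1" "g \<in> F2"
  shows "active_inj (conj_elt G h ` F2) (conj_elt G h g) =
    conj_elt S (active_inj F1 h) (active_inj F2 g)"
proof -
  interpret P: group P by (rule group_P)
  interpret S: group S by (rule group_active_sum)
  let ?i = "family_inj G \<F>" and ?q = "\<lambda>p. relator_closure #>\<^bsub>P\<^esub> p"
  interpret q: group_hom P S ?q
    by unfold_locales (rule projection_hom)
  let ?c = "?i (conj_elt G h ` F2) (conj_elt G h g)"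
  have cl: "?i F1 h \<in> carrier P" "?i F2 g \<in> carrier P" "?c \<in> carrier P"
    using assms by (auto intro!: family_inj_closed conj_image_closed)
  have "inv\<^bsub>P\<^esub> (?i F1 h) \<otimes>\<^bsub>P\<^esub> ?i F2 g \<otimes>\<^bsub>P\<^esub> ?i F1 h \<otimes>\<^bsub>P\<^esub> inv\<^bsub>P\<^esub> ?c \<in> relators"
    using assms unfolding active_sum_relators_def Let_def by blast
  then have "conj_elt P (?i F1 h) (?i F2 g) \<otimes>\<^bsub>P\<^esub> inv\<^bsub>P\<^esub> ?c \<in> relator_closure"
    using P.subset_normal_closure by (auto simp: conj_elt_def)
  then have "?q (conj_elt P (?i F1 h) (?i F2 g) \<otimes>\<^bsub>P\<^esub> inv\<^bsub>P\<^esub> ?c) = \<one>\<^bsub>S\<^esub>"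
    using subgroup.rcos_const[OF normal_imp_subgroup[OF relator_closure_normal] group_P]
    by (simp add: active_sum_eq)
  then have "conj_elt S (?q (?i F1 h)) (?q (?i F2 g)) \<otimes>\<^bsub>S\<^esub> inv\<^bsub>S\<^esub> (?q ?c) = \<one>\<^bsub>S\<^esub>"
    using cl by (simp add: conj_elt_def)
  moreover have "conj_elt S (?q (?i F1 h)) (?q (?i F2 g)) \<in> carrier S" "?q ?c \<in> carrier S"
    using cl by (simp_all add: conj_elt_def)
  ultimately have "conj_elt S (?q (?i F1 h)) (?q (?i F2 g)) = ?q ?c"
    using S.inv_solve_right'[OF S.one_closed] by simp
  then show ?thesis by (simp add: active_inj_def)
qed

text \<open>The images of the members of the family generate \<open>S\<close>, a quotient of their free product.\<close>

lemma active_sum_hom_eqI: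
  assumes "group X" and a: "a \<in> hom S X" and b: "b \<in> hom S X"
    and eq: "\<And>F x. F \<in> \<F> \<Longrightarrow> x \<in> F \<Longrightarrow> a (active_inj F x) = b (active_inj F x)"
    and "s \<in> carrier S"
  shows "a s = b s"
proof -
  let ?q = "\<lambda>p. relator_closure #>\<^bsub>P\<^esub> p"
  obtain p where p: "p \<in> carrier P" "s = ?q p"
    using \<open>s \<in> carrier S\<close> by (auto simp: active_sum_eq carrier_FactGroup)
  have "(a \<circ> ?q) p = (b \<circ> ?q) p"
  proof (rule free_product_hom_eqI[OF \<open>group X\<close>])
    show "a \<circ> ?q \<in> hom FP X" "b \<circ> ?q \<in> hom FP X"
      using Group.hom_compose[OF projection_hom a] Group.hom_compose[OF projection_hom b]
      by (simp_all add: family_free_product_def)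
  qed (use p eq in \<open>auto simp: family_free_product_def active_inj_def family_inj_def\<close>)
  with p show ?thesis by simp
qed

text \<open>The extension of the family to the free product sends every relator to the unit, which is
  what the compatibility with conjugation says. Its kernel then contains the normal closure of
  the relators, and the extension descends to the quotient.\<close>

lemma active_sum_universal:
  assumes "group X" and \<phi>: "\<And>F. F \<in> \<F> \<Longrightarrow> \<phi> F \<in> hom (G\<lparr>carrier := F\<rparr>) X"
    and conj: "\<And>F1 F2 h g. \<lbrakk>F1 \<in> \<F>; F2 \<in> \<F>; h \<in> F1; g \<in> F2\<rbrakk>
      \<Longrightarrow> \<phi> (conj_elt G h ` F2) (conj_elt G h g) = conj_elt X (\<phi> F1 h) (\<phi> F2 g)"
  shows "\<exists>\<Phi>\<in>hom S X. \<forall>F\<in>\<F>. \<forall>x\<in>F. \<Phi> (active_inj F x) = \<phi> F x"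
proof -
  interpret P: group P by (rule group_P)
  interpret X: group X by fact
  obtain \<Psi> where \<Psi>: "\<Psi> \<in> hom P X"
    and \<Psi>_inj: "\<And>F x. F \<in> \<F> \<Longrightarrow> x \<in> F \<Longrightarrow> \<Psi> (family_inj G \<F> F x) = \<phi> F x"
  proof -
    have "\<exists>\<Psi>\<in>hom FP X. \<forall>F\<in>\<F>. \<forall>x\<in>carrier (G\<lparr>carrier := F\<rparr>). \<Psi> (incl F x) = \<phi> F x"
      by (rule free_product_universal[OF \<open>group X\<close> \<phi>])
    then show thesis
      using that by (auto simp: family_free_product_def family_inj_def)
  qed
  interpret \<Psi>: group_hom P X \<Psi> by unfold_locales (rule \<Psi>)
  have \<phi>_closed: "\<phi> F x \<in> carrier X" if "F \<in> \<F>" "x \<in> F" for F x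
    using hom_in_carrier[OF \<phi>] that by fastforce
  have "\<Psi> r = \<one>\<^bsub>X\<^esub>" if r: "r \<in> relators" for r
  proof -
    obtain F1 F2 h g where F: "F1 \<in> \<F>" "F2 \<in> \<F>" and hg: "h \<in> F1" "g \<in> F2"
      and r: "r = inv\<^bsub>P\<^esub> (family_inj G \<F> F1 h) \<otimes>\<^bsub>P\<^esub> family_inj G \<F> F2 g \<otimes>\<^bsub>P\<^esub> family_inj G \<F> F1 h
        \<otimes>\<^bsub>P\<^esub> inv\<^bsub>P\<^esub> (family_inj G \<F> (conj_elt G h ` F2) (conj_elt G h g))"
      using r unfolding active_sum_relators_def Let_def by blast
    have C: "conj_elt G h ` F2 \<in> \<F>" "conj_elt G h g \<in> conj_elt G h ` F2"
      using F hg by (auto intro: conj_image_closed)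
    have "\<Psi> r = conj_elt X (\<phi> F1 h) (\<phi> F2 g) \<otimes>\<^bsub>X\<^esub> inv\<^bsub>X\<^esub> \<phi> (conj_elt G h ` F2) (conj_elt G h g)"
      using F hg C by (simp add: r \<Psi>_inj family_inj_closed conj_elt_def[of X])
    also have "\<dots> = \<one>\<^bsub>X\<^esub>"
      using conj[OF F hg] \<phi>_closed[OF C] by (metis X.r_inv)
    finally show ?thesis .
  qed
  then have "relators \<subseteq> kernel P X \<Psi>"
    using relators_closed by (auto simp: kernel_def)
  then have "relator_closure \<subseteq> kernel P X \<Psi>"
    by (rule P.normal_closure_minimal[OF \<Psi>.normal_kernel])
  then obtain \<Phi> where "\<Phi> \<in> hom S X"
    and \<Phi>: "\<And>p. p \<in> carrier P \<Longrightarrow> \<Phi> (relator_closure #>\<^bsub>P\<^esub> p) = \<Psi> p"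
    using \<Psi>.FactGroup_universal_kernel[OF relator_closure_normal] by (metis active_sum_eq)
  moreover have "\<Phi> (active_inj F x) = \<phi> F x" if "F \<in> \<F>" "x \<in> F" for F x
    using that by (simp add: active_inj_def \<Phi> \<Psi>_inj family_inj_closed)
  ultimately show ?thesis by blast
qed

end

section \<open>Torsion and cyclic groups\<close>

lemma pow_group_exponent_dvd:
  assumes "group G" "finite_exponent G" "group_exponent G dvd n" "x \<in> carrier G"
  shows "x [^]\<^bsub>G\<^esub> n = \<one>\<^bsub>G\<^esub>"
proof -
  interpret group G by fact
  let ?P = "\<lambda>m. 0 < m \<and> (\<forall>x\<in>carrier G. x [^]\<^bsub>G\<^esub> (m::nat) = \<one>\<^bsub>G\<^esub>)"
  have "\<exists>m. ?P m" using assms(2) by (simp add: finite_exponent_def)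
  then have "?P (LEAST m. ?P m)" by (rule LeastI_ex)
  then have "x [^]\<^bsub>G\<^esub> group_exponent G = \<one>\<^bsub>G\<^esub>"
    using assms by (simp add: group_exponent_def)
  then show ?thesis
    using assms(3,4) by (auto simp: pow_eq_id intro: dvd_trans)
qed

text \<open>The addition of the cyclic group is reduced modulo \<open>n\<close>, and \<open>x\<^sup>n = 1\<close> makes powers of \<open>x\<close>
  insensitive to that reduction.\<close>

lemma power_map_Hom:
  assumes "group X" "0 < n" "x \<in> carrier X" "x [^]\<^bsub>X\<^esub> n = \<one>\<^bsub>X\<^esub>"
  shows "restrict (\<lambda>k. x [^]\<^bsub>X\<^esub> (k::int)) (carrier (integer_mod_group n)) \<in> Hom (integer_mod_group n) X"
proof -
  interpret group X by fact
  have dvd: "ord x dvd n" using assms pow_eq_id by blast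
  have "x [^]\<^bsub>X\<^esub> ((k + l) mod int n) = x [^]\<^bsub>X\<^esub> k \<otimes>\<^bsub>X\<^esub> x [^]\<^bsub>X\<^esub> l" for k l :: int
  proof -
    have "int (ord x) dvd (k + l) - (k + l) mod int n"
      using dvd by (intro dvd_trans[OF _ dvd_minus_mod]) simp
    then have "x [^]\<^bsub>X\<^esub> ((k + l) mod int n) = x [^]\<^bsub>X\<^esub> (k + l)"
      by (rule iffD2[OF int_pow_eq[OF assms(3)]])
    then show ?thesis using assms by (simp add: int_pow_mult)
  qed
  then show ?thesis
    using assms by (auto simp: Hom_def hom_def carrier_integer_mod_group)
qed

lemma pow_conj_elt:
  assumes "group X" "x \<in> carrier X" "y \<in> carrier X"
  shows "conj_elt X x y [^]\<^bsub>X\<^esub> (m::nat) = conj_elt X x (y [^]\<^bsub>X\<^esub> m)"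
proof -
  interpret group X by fact
  have "x \<otimes>\<^bsub>X\<^esub> (inv\<^bsub>X\<^esub> x \<otimes>\<^bsub>X\<^esub> z) = z" if "z \<in> carrier X" for z
    using that assms by (simp add: inv_solve_left' m_assoc[symmetric])
  then show ?thesis
    using assms by (induction m) (simp_all add: conj_elt_def m_assoc)
qed

text \<open>If \<open>f x = f y\<close>, then the homomorphisms from \<open>C\<^sub>n\<close> with generator images \<open>x\<close> and \<open>y\<close> have the
  same composite with \<open>f\<close>, so they coincide.\<close>

lemma equivalence_cyclic_inj_on_torsion:
  assumes eqv: "equivalence_wrt (integer_mod_group n) X Y f" and "0 < n" "group X" "group Y"
    and x: "x \<in> carrier X" "x [^]\<^bsub>X\<^esub> n = \<one>\<^bsub>X\<^esub>" and y: "y \<in> carrier X" "y [^]\<^bsub>X\<^esub> n = \<one>\<^bsub>X\<^esub>"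
    and "f x = f y"
  shows "x = y"
proof (cases "n = 1")
  \<comment> \<open>The representative \<open>1\<close> of the generator lies outside the carrier \<open>{0}\<close> of \<open>C\<^sub>1\<close>.\<close>
  case True
  interpret group X by fact
  show ?thesis using x y True by simp
next
  case False
  interpret X: group X by fact
  interpret Y: group Y by fact
  let ?C = "carrier (integer_mod_group n)"
  interpret f: group_hom X Y f
    using eqv by unfold_locales (simp add: equivalence_wrt_def)
  let ?p = "\<lambda>x. restrict (\<lambda>k. x [^]\<^bsub>X\<^esub> (k::int)) ?C"
  have "compose ?C f (?p x) = compose ?C f (?p y)"
    using x y \<open>f x = f y\<close> by (auto simp: compose_def f.hom_int_pow)
  then have "?p x = ?p y"
    using eqv power_map_Hom[OF \<open>group X\<close> \<open>0 < n\<close>] x y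
    by (auto simp: equivalence_wrt_def bij_betw_def inj_on_def)
  then have "?p x 1 = ?p y 1" by simp
  then show ?thesis using False x y by (simp add: X.int_pow_1)
qed

lemma compose_Hom:
  assumes "group A" "f \<in> hom X Y" "t \<in> Hom A X"
  shows "compose (carrier A) f t \<in> Hom A Y"
proof -
  interpret group A by fact
  show ?thesis using assms by (auto simp: Hom_def hom_def compose_def Pi_def)
qed

lemma restrict_Hom:
  assumes "group A" "t \<in> hom A X"
  shows "restrict t (carrier A) \<in> Hom A X"
proof -
  interpret group A by fact
  show ?thesis using assms by (auto simp: Hom_def hom_def)
qed

theorem theorem5:
  fixes G :: "('a, 'b) monoid_scheme" and \<F> :: "'a set set" and n :: nat
  assumes "group G"
    and "\<And>F. F \<in> \<F> \<Longrightarrow> subgroup F G"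
    and "\<And>F. F \<in> \<F> \<Longrightarrow> finite_exponent (G\<lparr>carrier := F\<rparr>)"
    and "\<And>F g. \<lbrakk>F \<in> \<F>; g \<in> carrier G\<rbrakk> \<Longrightarrow> conj_elt G g ` F \<in> \<F>"
    and "0 < n"
    and "\<And>F. F \<in> \<F> \<Longrightarrow> group_exponent (G\<lparr>carrier := F\<rparr>) dvd n"
    and "\<And>F. F \<in> \<F> \<Longrightarrow>
      cellular TYPE('x) TYPE('y) (integer_mod_group n) (G\<lparr>carrier := F\<rparr>)"
  shows "cellular TYPE('x) TYPE('y) (integer_mod_group n) (active_sum G \<F>)"
proof -
  interpret conjugation_closed_family G \<F>
    using assms by (simp add: conjugation_closed_family_def conjugation_closed_family_axioms_def)
  have "equivalence_wrt S X Y f"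
    if X: "group X" and Y: "group Y" and eqv: "equivalence_wrt (integer_mod_group n) X Y f"
    for X :: "'x monoid" and Y :: "'y monoid" and f
  proof -
    interpret X: group X by fact
    interpret Y: group Y by fact
    interpret S: group S by (rule group_active_sum)
    have f: "f \<in> hom X Y" using eqv by (simp add: equivalence_wrt_def)
    interpret f: group_hom X Y f by unfold_locales (rule f)
    have bij: "bij_betw (\<lambda>t. compose F f t) (Hom (G\<lparr>carrier := F\<rparr>) X) (Hom (G\<lparr>carrier := F\<rparr>) Y)"
      if "F \<in> \<F>" for F
      using assms(7)[OF that] X Y eqv by (simp add: cellular_def equivalence_wrt_def)
    have group_F: "group (G\<lparr>carrier := F\<rparr>)" if "F \<in> \<F>" for F
      using that by (rule group_factor)
    have inj: "inj_on (\<lambda>t. compose (carrier S) f t) (Hom S X)"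
    proof (rule inj_onI)
      fix s t assume s: "s \<in> Hom S X" and t: "t \<in> Hom S X"
        and eq: "compose (carrier S) f s = compose (carrier S) f t"
      have "s (active_inj F x) = t (active_inj F x)" if F: "F \<in> \<F>" and x: "x \<in> F" for F x
      proof -
        let ?r = "\<lambda>u. restrict (u \<circ> active_inj F) F"
        have r: "?r u \<in> Hom (G\<lparr>carrier := F\<rparr>) X" if "u \<in> Hom S X" for u
          using restrict_Hom[OF group_F[OF F] Group.hom_compose[OF active_inj_hom[OF F]], of u X] that
          by (simp add: Hom_def)
        have "f (s z) = f (t z)" if "z \<in> carrier S" for z
          using fun_cong[OF eq, of z] that by (simp add: compose_def)
        then have "compose F f (?r s) = compose F f (?r t)"
          using hom_in_carrier[OF active_inj_hom[OF F]] by (auto simp: compose_def)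
        then have "?r s = ?r t"
          using bij[OF F] r[OF s] r[OF t] by (auto simp: bij_betw_def dest: inj_onD)
        from fun_cong[OF this, of x] x show ?thesis by simp
      qed
      then have "s z = t z" if "z \<in> carrier S" for z
        using active_sum_hom_eqI[OF X _ _ _ that] s t by (auto simp: Hom_def)
      then show "s = t"
        using s t by (auto simp: Hom_def intro: extensionalityI)
    qed
    have surj: "\<exists>s\<in>Hom S X. compose (carrier S) f s = t" if t: "t \<in> Hom S Y" for t
    proof -
      have t_hom: "t \<in> hom S Y" using t by (simp add: Hom_def)
      interpret t: group_hom S Y t by unfold_locales (rule t_hom)
      have "\<exists>\<phi>. \<phi> \<in> hom (G\<lparr>carrier := F\<rparr>) X \<and> (\<forall>x\<in>F. f (\<phi> x) = t (active_inj F x))"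
        if F: "F \<in> \<F>" for F
      proof -
        have "restrict (t \<circ> active_inj F) F \<in> Hom (G\<lparr>carrier := F\<rparr>) Y"
          using restrict_Hom[OF group_F[OF F] Group.hom_compose[OF active_inj_hom[OF F] t_hom]] by simp
        then obtain \<phi> where "\<phi> \<in> Hom (G\<lparr>carrier := F\<rparr>) X"
          and eq: "compose F f \<phi> = restrict (t \<circ> active_inj F) F"
          using bij[OF F] by (metis (no_types, lifting) bij_betw_imp_surj_on imageE)
        moreover have "f (\<phi> x) = t (active_inj F x)" if "x \<in> F" for x
          using fun_cong[OF eq, of x] that by (simp add: compose_def)
        ultimately show ?thesis by (auto simp: Hom_def)
      qed
      then obtain \<phi> where \<phi>: "\<And>F. F \<in> \<F> \<Longrightarrow> \<phi> F \<in> hom (G\<lparr>carrier := F\<rparr>) X"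
        and f\<phi>: "\<And>F x. F \<in> \<F> \<Longrightarrow> x \<in> F \<Longrightarrow> f (\<phi> F x) = t (active_inj F x)"
        by metis
      have \<phi>_closed: "\<phi> F x \<in> carrier X" if "F \<in> \<F>" "x \<in> F" for F x
        using hom_in_carrier[OF \<phi>] that by fastforce
      have active_closed: "active_inj F x \<in> carrier S" if "F \<in> \<F>" "x \<in> F" for F x
        using hom_in_carrier[OF active_inj_hom] that by fastforce
      have torsion: "\<phi> F x [^]\<^bsub>X\<^esub> n = \<one>\<^bsub>X\<^esub>" if "F \<in> \<F>" "x \<in> F" for F x
      proof -
        interpret \<phi>: group_hom "G\<lparr>carrier := F\<rparr>" X "\<phi> F"
          using that group_F \<phi> X by (simp add: group_hom_def group_hom_axioms_def)
        have "x [^]\<^bsub>G\<lparr>carrier := F\<rparr>\<^esub> n = \<one>\<^bsub>G\<lparr>carrier := F\<rparr>\<^esub>"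
          using that group_F assms by (intro pow_group_exponent_dvd) auto
        then show ?thesis
          using \<phi>.hom_nat_pow[of x n] \<phi>.hom_one that by simp
      qed
      \<comment> \<open>Both sides are killed by \<open>n\<close>, and \<open>f\<close> identifies them because \<open>t\<close> respects the
        relations of the active sum.\<close>
      have "\<phi> (conj_elt G h ` F2) (conj_elt G h g) = conj_elt X (\<phi> F1 h) (\<phi> F2 g)"
        if F: "F1 \<in> \<F>" "F2 \<in> \<F>" and hg: "h \<in> F1" "g \<in> F2" for F1 F2 h g
      proof (rule equivalence_cyclic_inj_on_torsion[OF eqv \<open>0 < n\<close> X Y])
        have C: "conj_elt G h ` F2 \<in> \<F>" "conj_elt G h g \<in> conj_elt G h ` F2"
          using F hg by (auto intro: conj_image_closed)
        show "\<phi> (conj_elt G h ` F2) (conj_elt G h g) \<in> carrier X"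
          "\<phi> (conj_elt G h ` F2) (conj_elt G h g) [^]\<^bsub>X\<^esub> n = \<one>\<^bsub>X\<^esub>"
          using C \<phi>_closed torsion by auto
        show "conj_elt X (\<phi> F1 h) (\<phi> F2 g) \<in> carrier X"
          using F hg \<phi>_closed by (simp add: conj_elt_def)
        show "conj_elt X (\<phi> F1 h) (\<phi> F2 g) [^]\<^bsub>X\<^esub> n = \<one>\<^bsub>X\<^esub>"
          using F hg \<phi>_closed torsion by (simp add: pow_conj_elt[OF X]) (simp add: conj_elt_def)
        have "f (\<phi> (conj_elt G h ` F2) (conj_elt G h g)) =
            conj_elt Y (t (active_inj F1 h)) (t (active_inj F2 g))"
          using F hg C by (simp add: f\<phi> active_inj_conj active_closed conj_elt_def[of S] conj_elt_def[of Y])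
        also have "\<dots> = f (conj_elt X (\<phi> F1 h) (\<phi> F2 g))"
          using F hg by (simp add: f\<phi> \<phi>_closed conj_elt_def)
        finally show "f (\<phi> (conj_elt G h ` F2) (conj_elt G h g)) = f (conj_elt X (\<phi> F1 h) (\<phi> F2 g))" .
      qed
      with \<phi> have "\<exists>\<Phi>\<in>hom S X. \<forall>F\<in>\<F>. \<forall>x\<in>F. \<Phi> (active_inj F x) = \<phi> F x"
        by (rule active_sum_universal[OF X])
      then obtain \<Phi> where \<Phi>: "\<Phi> \<in> hom S X"
        and \<Phi>_inj: "\<And>F x. F \<in> \<F> \<Longrightarrow> x \<in> F \<Longrightarrow> \<Phi> (active_inj F x) = \<phi> F x"
        by blast
      have "(f \<circ> \<Phi>) z = t z" if "z \<in> carrier S" for z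
        using active_sum_hom_eqI[OF Y Group.hom_compose[OF \<Phi> f] t_hom _ that] \<Phi>_inj f\<phi> by simp
      then have "compose (carrier S) f (restrict \<Phi> (carrier S)) = t"
        using t by (intro extensionalityI[of _ "carrier S"]) (simp_all add: Hom_def compose_def)
      then show ?thesis
        using restrict_Hom[OF S.is_group \<Phi>] by blast
    qed
    have "bij_betw (\<lambda>t. compose (carrier S) f t) (Hom S X) (Hom S Y)"
      unfolding bij_betw_def
    proof (intro conjI inj subset_antisym image_subsetI subsetI)
      show "compose (carrier S) f s \<in> Hom S Y" if "s \<in> Hom S X" for s
        by (rule compose_Hom[OF S.is_group f that])
      show "t \<in> (\<lambda>s. compose (carrier S) f s) ` Hom S X" if "t \<in> Hom S Y" for t
        using surj[OF that] by blast
    qed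
    with f show ?thesis by (simp add: equivalence_wrt_def)
  qed
  then show ?thesis by (simp add: cellular_def)
qed

end
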